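(* Let $U=(u_n)_{n\ge0}$ be a Pisot numeration associated to $\beta$. If the numeration $U$ preserves zeros, then $\beta$ satisfies Condition F.
   Context: A Pisot number is a real algebraic integer $\beta>1$ all of whose other Galois conjugates have modulus strictly less than $1$. Let $P(X)=X^d-a_{d-1}X^{d-1}-\cdots-a_1X-a_0\in\mathbb{Z}[X]$ be its minimal polynomial. A Pisot numeration of degree $d$ associated to $\beta$ is a sequence $U=(u_n)_{n\ge0}$ of strictly positive integers with $u_0=1$, given by integer initial conditions $u_0=1,u_{-1},\dots,u_{-d+1}$ and the recurrence $u_n=a_{d-1}u_{n-1}+\cdots+a_0u_{n-d}$ for all $n\ge1$. Finite sequences of integers $g=g_k\cdots g_0\in\mathbb{Z}^*$ are identified with sequences $(g_n)_{n\ge0}$ with $g_n=0$ for $n>k$; $[g]_U=\sum_i g_iu_i$. For $n\in\mathbb{N}$, $(n)_U$ is the normalised (greedy) expansion of $n$: the lexicographically greatest finite sequence $(d_i)_{i\ge 0}$ of non-negative integers with $\sum_i d_iu_i=n$, characterised by $\sum_{i=0}^{\ell}d_iu_i<u_{\ell+1}$ for each $\ell\ge0$. $\operatorname{ord}(g)=\inf\{n:g_n\ne0\}$ ($=\infty$ for the zero sequence), $\|g\|_\infty=\sup_n|g_n|$, $\nu_U(n)=\operatorname{ord}((|n|)_U)$ for $n\in\mathbb{Z}$, and $\nu_U(g)=\nu_U([g]_U)$ for finite $g$. $U$ preserves zeros if for each natural number $c$ there is a constant $K_c$ such that $\nu_U(g)\ge\operatorname{ord}(g)-K_c$ for each $g\in\mathbb{Z}^*$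 with $\|g\|_\infty\le c$. The (normalised, greedy) $\beta$-expansion of a real $x\ge0$ is the unique sequence of non-negative integers $(d_i)_{i\le n}$ with $x=\sum_{i\le n}d_i\beta^i$ and $\sum_{i\le k}d_i\beta^i<\beta^{k+1}$ for each $k\le n$ (leading zeros being disregarded). $\operatorname{Fin}(\beta)$ is the set of $x\ge0$ whose $\beta$-expansion is finite (has finitely many non-zero digits). $\beta$ satisfies Condition F if every non-negative element of $\mathbb{Z}[\beta]$ belongs to $\operatorname{Fin}(\beta)$. *)

theory Defs
  imports
    "HOL-Analysis.Analysis"
    "HOL-Computational_Algebra.Computational_Algebra"
    "HOL-Library.Extended_Nat"
begin

section \<open>Pisot numbers\<close>

definition is_min_poly :: "real \<Rightarrow> rat poly \<Rightarrow> bool" where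
  "is_min_poly x p \<longleftrightarrow>
     lead_coeff p = 1 \<and> irreducible p \<and> poly (map_poly of_rat p) x = 0"

definition galois_conjugates :: "real \<Rightarrow> complex set" where
  "galois_conjugates x = {z. \<exists>p. is_min_poly x p \<and> poly (map_poly of_rat p) z = 0}"

definition pisot :: "real \<Rightarrow> bool" where
  "pisot \<beta> \<longleftrightarrow> \<beta> > 1 \<and> algebraic_int \<beta> \<and>
     (\<forall>z \<in> galois_conjugates \<beta> - {of_real \<beta>}. cmod z < 1)"

section \<open>Pisot numerations\<close>

text \<open>
  The minimal polynomial is \<open>P = X^d - a\<^sub>d\<^sub>-\<^sub>1 X^(d-1) - \<dots> - a\<^sub>0\<close>, so \<open>a\<^sub>i = - coeff P i\<close>.
  The auxiliary \<open>v\<close> extends \<open>U\<close> to the negative indices of the initial conditions;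
  only its values at indices \<open>\<ge> - d + 1\<close> matter. Since \<open>0 \<le> i < d\<close>,
  the index \<open>n - d + i\<close> runs through \<open>n - d, \<dots>, n - 1\<close>.
\<close>

definition pisot_numeration :: "real \<Rightarrow> (nat \<Rightarrow> int) \<Rightarrow> bool" where
  "pisot_numeration \<beta> U \<longleftrightarrow>
     pisot \<beta> \<and> (\<forall>n. U n > 0) \<and> U 0 = 1 \<and>
     (\<exists>(P :: int poly) (v :: int \<Rightarrow> int).
        is_min_poly \<beta> (map_poly of_int P) \<and>
        (\<forall>n. v (int n) = U n) \<and>
        (\<forall>n\<ge>1. v n = (\<Sum>i<degree P. - coeff P i * v (n - int (degree P) + int i))))"

section \<open>Finite digit sequences and greedy expansions of integers\<close>

definition finite_seqs :: "(nat \<Rightarrow> int) set" where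
  "finite_seqs = {g. finite {i. g i \<noteq> 0}}"

definition seq_value :: "(nat \<Rightarrow> int) \<Rightarrow> (nat \<Rightarrow> int) \<Rightarrow> int" where
  "seq_value U g = (\<Sum>i | g i \<noteq> 0. g i * U i)"

definition ord_seq :: "(nat \<Rightarrow> int) \<Rightarrow> enat" where
  "ord_seq g = (INF n \<in> {n. g n \<noteq> 0}. enat n)"

definition sup_norm_seq :: "(nat \<Rightarrow> int) \<Rightarrow> int" where
  "sup_norm_seq g = (SUP n. \<bar>g n\<bar>)"

definition representations :: "(nat \<Rightarrow> int) \<Rightarrow> nat \<Rightarrow> (nat \<Rightarrow> int) set" where
  "representations U n = {d \<in> finite_seqs. (\<forall>i. d i \<ge> 0) \<and> seq_value U d = int n}"

text \<open>
  Words are written with the most significant digit first, so the lexicographic order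
  is decided at the highest position at which the two sequences differ.
\<close>

definition lex_less :: "(nat \<Rightarrow> int) \<Rightarrow> (nat \<Rightarrow> int) \<Rightarrow> bool" where
  "lex_less e d \<longleftrightarrow> (\<exists>j. e j < d j \<and> (\<forall>i>j. e i = d i))"

definition is_greedy :: "(nat \<Rightarrow> int) \<Rightarrow> nat \<Rightarrow> (nat \<Rightarrow> int) \<Rightarrow> bool" where
  "is_greedy U n d \<longleftrightarrow>
     d \<in> representations U n \<and> (\<forall>e \<in> representations U n. e = d \<or> lex_less e d)"

definition greedy_expansion :: "(nat \<Rightarrow> int) \<Rightarrow> nat \<Rightarrow> (nat \<Rightarrow> int)" where
  "greedy_expansion U n = (THE d. is_greedy U n d)"

definition nu :: "(nat \<Rightarrow> int) \<Rightarrow> int \<Rightarrow> enat" where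
  "nu U n = ord_seq (greedy_expansion U (nat \<bar>n\<bar>))"

text \<open>The inequality \<open>\<nu>(g) \<ge> ord(g) - K\<close> is stated additively to avoid truncated subtraction.\<close>

definition preserves_zeros :: "(nat \<Rightarrow> int) \<Rightarrow> bool" where
  "preserves_zeros U \<longleftrightarrow>
     (\<forall>c :: nat. \<exists>K :: nat. \<forall>g \<in> finite_seqs.
        sup_norm_seq g \<le> int c \<longrightarrow> ord_seq g \<le> nu U (seq_value U g) + enat K)"

lemma lex_less_asym: "lex_less d e \<Longrightarrow> \<not> lex_less e d"
  unfolding lex_less_def by (metis less_asym less_irrefl linorder_neqE_nat)

lemma greedy_expansion_eqI: "is_greedy U n d \<Longrightarrow> greedy_expansion U n = d"
  unfolding greedy_expansion_def
proof (rule the_equality)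
  fix e
  assume "is_greedy U n d" "is_greedy U n e"
  hence "e = d \<or> lex_less e d" "d = e \<or> lex_less d e" by (simp_all add: is_greedy_def)
  thus "e = d" using lex_less_asym[of d e] by metis
qed

lemma seq_value_eq_sum:
  assumes "\<forall>i>N. g i = 0"
  shows "seq_value U g = (\<Sum>i\<le>N. g i * U i)"
  proof -
  have "{i. g i \<noteq> 0} \<subseteq> {..N}" using assms by (auto simp: not_le[symmetric])
  thus ?thesis unfolding seq_value_def by (intro sum.mono_neutral_left) auto
qed

lemma finite_seqs_bound:
  assumes "g \<in> finite_seqs"
  obtains N where "N \<ge> M" "\<forall>i>N. g i = 0"
proof -
  have fin: "finite {i. g i \<noteq> 0}" using assms by (simp add: finite_seqs_def)
  then obtain k where k: "{i. g i \<noteq> 0} \<subseteq> {..k}" using finite_nat_iff_bounded_le by blast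
  show ?thesis by (rule that[of "max M k"]) (use k in force)+
qed

lemma seq_value_split:
  assumes "\<forall>i>N. g i = 0" "l \<le> N"
  shows "seq_value U g = (\<Sum>i\<le>l. g i * U i) + (\<Sum>i\<in>{l<..N}. g i * U i)"
proof -
  have "{..N} = {..l} \<union> {l<..N}" using assms(2) by auto
  thus ?thesis
    unfolding seq_value_eq_sum[OF assms(1)] by (subst sum.union_disjoint[symmetric]) auto
qed

text \<open>
  The greatest representation is characterised by the greedy inequalities; this needs
  no monotonicity of \<open>U\<close>.
\<close>

lemma is_greedy_iff:
  assumes pos: "\<And>n. U n > 0" and U0: "U 0 = 1"
  shows "is_greedy U n d \<longleftrightarrow>
    d \<in> representations U n \<and> (\<forall>l. (\<Sum>i\<le>l. d i * U i) < U (Suc l))"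
proof (intro iffI conjI allI)
  assume "is_greedy U n d"
  thus d: "d \<in> representations U n" by (simp add: is_greedy_def)
  fix l
  show "(\<Sum>i\<le>l. d i * U i) < U (Suc l)"
  proof (rule ccontr)
    assume neg: "\<not> ?thesis"
    obtain N where N: "N \<ge> Suc l" "\<forall>i>N. d i = 0"
      using d finite_seqs_bound[of d "Suc l"] by (auto simp: representations_def)
    define r where "r = (\<Sum>i\<le>l. d i * U i) - U (Suc l)"
    define e where
      "e = (\<lambda>i. if i = 0 then r else if i \<le> l then 0
                else if i = Suc l then d i + 1 else d i)"
    have eN: "\<forall>i>N. e i = 0" using N by (auto simp: e_def)
    have "r \<ge> 0" using neg by (simp add: r_def)
    moreover have "finite {i. e i \<noteq> 0}"
      using eN by (meson finite_nat_set_iff_bounded_le mem_Collect_eq not_le)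
    moreover have "seq_value U e = int n"
    proof -
      have low: "(\<Sum>i\<le>l. e i * U i) = r"
      proof -
        have "(\<Sum>i\<le>l. e i * U i) = (\<Sum>i\<le>l. if i = 0 then r else 0)"
          by (intro sum.cong) (auto simp: e_def U0)
        thus ?thesis by simp
      qed
      have "(\<Sum>i\<in>{l<..N}. e i * U i)
          = (\<Sum>i\<in>{l<..N}. d i * U i + (if i = Suc l then U (Suc l) else 0))"
        by (intro sum.cong) (auto simp: e_def algebra_simps)
      also have "\<dots> = (\<Sum>i\<in>{l<..N}. d i * U i) + U (Suc l)"
        using N by (simp add: sum.distrib)
      finally show ?thesis
        using low d seq_value_split[OF eN, of l U] seq_value_split[OF N(2), of l U] N(1)
        by (simp add: representations_def r_def)
    qed
    ultimately have "e \<in> representations U n"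
      using d by (auto simp: representations_def finite_seqs_def e_def)
    moreover have "lex_less d e"
      unfolding lex_less_def by (rule exI[of _ "Suc l"]) (auto simp: e_def)
    ultimately show False
      using \<open>is_greedy U n d\<close> lex_less_asym by (metis is_greedy_def)
  qed
next
  assume *: "d \<in> representations U n \<and> (\<forall>l. (\<Sum>i\<le>l. d i * U i) < U (Suc l))"
  have "e = d \<or> lex_less e d" if e: "e \<in> representations U n" for e
  proof (rule ccontr)
    assume neg: "\<not> ?thesis"
    obtain N1 where N1: "\<forall>i>N1. d i = 0"
      using * finite_seqs_bound[of d 0] by (auto simp: representations_def)
    obtain N where N: "N \<ge> N1" "\<forall>i>N. e i = 0"
      using e finite_seqs_bound[of e N1] by (auto simp: representations_def)
    have dN: "\<forall>i>N. d i = 0" using N N1 by auto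
    define D where "D = {i. e i \<noteq> d i}"
    have DN: "i \<le> N" if "i \<in> D" for i
      using that N(2) dN unfolding D_def by (metis (mono_tags, lifting) mem_Collect_eq not_le)
    hence fin: "finite D" by (meson finite_nat_set_iff_bounded_le)
    have "D \<noteq> {}" using neg by (auto simp: D_def)
    define j where "j = Max D"
    have jD: "j \<in> D" unfolding j_def using fin \<open>D \<noteq> {}\<close> by (rule Max_in)
    have "e i = d i" if "i > j" for i
    proof -
      have "i \<notin> D" using Max_ge[OF fin, of i] that unfolding j_def by linarith
      thus ?thesis by (simp add: D_def)
    qed
    hence j: "e j \<noteq> d j" "\<forall>i>j. e i = d i" "j \<le> N"
      using jD DN[OF jD] by (simp_all add: D_def)
    hence gt: "e j > d j" using neg unfolding lex_less_def by (meson linorder_neqE)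
    have "(\<Sum>i\<in>{j<..N}. e i * U i) = (\<Sum>i\<in>{j<..N}. d i * U i)"
      using j by (intro sum.cong) auto
    hence eq: "(\<Sum>i\<le>j. e i * U i) = (\<Sum>i\<le>j. d i * U i)"
      using seq_value_split[OF N(2) j(3), of U] seq_value_split[OF dN j(3), of U] e *
      by (simp add: representations_def)
    show False
    proof (cases j)
      case 0
      thus False using eq gt U0 by simp
    next
      case (Suc l)
      have "(\<Sum>i\<le>l. e i * U i) \<ge> 0"
        using e pos by (intro sum_nonneg mult_nonneg_nonneg) 
          (auto simp: representations_def less_imp_le)
      moreover have "(\<Sum>i\<le>l. d i * U i) < U j" using * Suc by simp
      moreover have "(d j + 1) * U j \<le> e j * U j"
        using gt pos[of j] by (intro mult_right_mono) auto
      ultimately show False using eq Suc by (simp add: algebra_simps)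
    qed
  qed
  thus "is_greedy U n d" using * by (simp add: is_greedy_def)
qed

section \<open>Beta-expansions and Condition F\<close>

text \<open>
  Digits are indexed by all integers, those beyond a leading position \<open>n\<close> being zero. This
  makes the expansion independent of the choice of \<open>n\<close>, i.e. of leading zeros.
\<close>

definition is_beta_expansion :: "real \<Rightarrow> real \<Rightarrow> (int \<Rightarrow> nat) \<Rightarrow> bool" where
  "is_beta_expansion \<beta> x d \<longleftrightarrow>
     (\<exists>n. (\<forall>i>n. d i = 0) \<and>
          ((\<lambda>i. real (d i) * \<beta> powi i) has_sum x) {..n} \<and>
          (\<forall>k\<le>n. (\<Sum>\<^sub>\<infinity>i\<in>{..k}. real (d i) * \<beta> powi i) < \<beta> powi (k + 1)))"

definition Fin :: "real \<Rightarrow> real set" where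
  "Fin \<beta> = {x. x \<ge> 0 \<and> (\<exists>d. is_beta_expansion \<beta> x d \<and> finite {i. d i \<noteq> 0})}"

definition Z_adjoin :: "real \<Rightarrow> real set" where
  "Z_adjoin \<beta> = {poly (map_poly of_int p) \<beta> | p :: int poly. True}"

definition condition_F :: "real \<Rightarrow> bool" where
  "condition_F \<beta> \<longleftrightarrow> (\<forall>x \<in> Z_adjoin \<beta>. x \<ge> 0 \<longrightarrow> x \<in> Fin \<beta>)"

end

theory Submission
  imports Defs "HOL-Computational_Algebra.Field_as_Ring"
begin

text \<open>
  Let \<open>x = p(\<beta>) \<ge> 0\<close> for an integer polynomial \<open>p\<close>. Placing the coefficients of \<open>p\<close> at position \<open>m\<close>
  of the numeration gives the integer \<open>\<Sum>\<^sub>j p\<^sub>j U (m + j)\<close>, and \<open>U (n + 1) / U n\<close> tends to \<open>\<beta>\<close>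
  (\<open>pisot_numeration_ratio_tendsto\<close>), so this integer is asymptotic to \<open>x U m\<close> if \<open>x > 0\<close>. The
  placed sequences have a common norm bound. As zeros are preserved, there is a constant \<open>K\<close> such
  that the greedy expansion of the integer, or of its absolute value, has only zeros below
  position \<open>m - K\<close>.

  On the other hand the greedy digits are bounded and the leading digit is at most a bounded
  distance above \<open>m\<close>. So the expansions, read off from position \<open>m - K\<close>, are words over a finite
  alphabet of bounded length, and some word \<open>w\<close> occurs for infinitely many \<open>m\<close>. Dividing by
  \<open>U (m - K)\<close> and letting \<open>m\<close> grow along these shows that \<open>w\<close>, read in base \<open>\<beta>\<close>, represents
  \<open>\<beta> ^ K * x\<close> and satisfies the greedy inequalities in their weak form (\<open>limit_greedy_word\<close>). This is
  almost a finite \<open>\<beta>\<close>-expansion of \<open>x\<close>; the possible equalities among the greedy inequalities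
  disappear after one carry (\<open>carry_to_strictly_greedy\<close>).

  The convergence of the ratios is where the Pisot property enters: \<open>U (n + 1) - \<beta> U n\<close> satisfies a
  recurrence whose characteristic roots are the conjugates of \<open>\<beta>\<close> other than \<open>\<beta>\<close>, all inside the
  unit disc, so it tends to \<open>0\<close>.
\<close>

section \<open>Linear recurrences as polynomials in the shift\<close>

text \<open>
  This is the operator \<open>p(T)\<close>, for \<open>T\<close> the shift \<open>s \<mapsto> (\<lambda>n. s (n + 1))\<close>. A linear recurrence
  with characteristic polynomial \<open>p\<close> is the equation \<open>p(T) s = 0\<close>.
\<close>

definition shift_poly :: "'a::comm_ring_1 poly \<Rightarrow> (nat \<Rightarrow> 'a) \<Rightarrow> nat \<Rightarrow> 'a" where
  "shift_poly p s n = (\<Sum>i\<le>degree p. coeff p i * s (n + i))"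

lemma shift_poly_eq_sum:
  "degree p \<le> N \<Longrightarrow> shift_poly p s n = (\<Sum>i\<le>N. coeff p i * s (n + i))"
  unfolding shift_poly_def
  by (intro sum.mono_neutral_left) (auto simp: coeff_eq_0 not_le)

lemma shift_poly_linear_factor:
  "shift_poly ([:-z, 1:] * q) s n = shift_poly q s (Suc n) - z * shift_poly q s n"
proof -
  let ?N = "degree q"
  have *: "[:-z, 1:] * q = smult (-z) q + pCons 0 q" by simp
  have "degree ([:-z, 1:] * q) \<le> Suc ?N"
    unfolding * by (intro degree_add_le order.trans[OF degree_smult_le] order.trans[OF degree_pCons_le]) auto
  hence "shift_poly ([:-z, 1:] * q) s n
      = (\<Sum>i\<le>Suc ?N. (coeff (smult (-z) q) i + coeff (pCons 0 q) i) * s (n + i))"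
    unfolding * by (simp only: shift_poly_eq_sum coeff_add)
  also have "\<dots> = (\<Sum>i\<le>Suc ?N. coeff (pCons 0 q) i * s (n + i))
      - z * (\<Sum>i\<le>Suc ?N. coeff q i * s (n + i))"
    by (simp only: coeff_smult distrib_right sum.distrib sum_distrib_left) 
       (simp add: sum_negf algebra_simps)
  also have "(\<Sum>i\<le>Suc ?N. coeff (pCons 0 q) i * s (n + i)) = shift_poly q s (Suc n)"
    by (subst sum.atMost_Suc_shift) (simp add: shift_poly_def)
  also have "(\<Sum>i\<le>Suc ?N. coeff q i * s (n + i)) = shift_poly q s n"
    by (subst shift_poly_eq_sum[of q "Suc ?N"]) auto
  finally show ?thesis .
qed

text \<open>
  Operators \<open>p(T)\<close> commute, so the factor \<open>T - z\<close> may be applied last, as in the previous lemma,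
  or first, as here. Peeling off roots of a polynomial calls for the former; eliminating the
  dominant root from a solution calls for the latter.
\<close>

lemma shift_poly_linear_factor':
  "shift_poly ([:-z, 1:] * q) s = shift_poly q (\<lambda>n. s (Suc n) - z * s n)"
  by (rule ext, subst shift_poly_linear_factor)
     (simp add: shift_poly_def algebra_simps sum_subtractf sum_distrib_left)

text \<open>
  Writing \<open>t (n + 1) = z t n + \<epsilon>\<^sub>n\<close>, the sequence is a discounted sum of past errors: errors below
  \<open>\<delta> (1 - \<bar>z\<bar>)\<close> add up to at most \<open>\<delta>\<close> by the geometric series, and the initial value is
  damped by \<open>\<bar>z\<bar>^k\<close>.
\<close>

lemma contracting_recurrence_tendsto_0:
  fixes t :: "nat \<Rightarrow> 'a::real_normed_field"
  assumes "norm z < 1" and lim: "(\<lambda>n. t (Suc n) - z * t n) \<longlonglongrightarrow> 0"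
  shows "t \<longlonglongrightarrow> 0"
proof (rule tendsto_norm_zero_cancel, rule LIMSEQ_I)
  fix \<epsilon> :: real assume "\<epsilon> > 0"
  define \<delta> where "\<delta> = \<epsilon> / 2"
  have \<delta>: "\<delta> > 0" "\<epsilon> = \<delta> + \<delta>" using \<open>\<epsilon> > 0\<close> by (auto simp: \<delta>_def)
  define r where "r = norm z"
  have r: "0 \<le> r" "r < 1" using assms by (auto simp: r_def)
  have "\<delta> * (1 - r) > 0" using r \<delta> by simp
  from LIMSEQ_D[OF lim this] obtain M
    where M: "\<And>n. n \<ge> M \<Longrightarrow> norm (t (Suc n) - z * t n) < \<delta> * (1 - r)" by auto
  have bound: "norm (t (M + k)) \<le> r ^ k * norm (t M) + \<delta>" for k
  proof (induction k)
    case 0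
    thus ?case using \<delta> by simp
  next
    case (Suc k)
    have "norm (t (M + Suc k)) \<le> norm (t (Suc (M + k)) - z * t (M + k)) + norm (z * t (M + k))"
      using norm_triangle_ineq[of "t (Suc (M + k)) - z * t (M + k)" "z * t (M + k)"] by simp
    also have "\<dots> \<le> \<delta> * (1 - r) + r * norm (t (M + k))"
      using M[of "M + k"] by (simp add: norm_mult r_def)
    also have "\<dots> \<le> \<delta> * (1 - r) + r * (r ^ k * norm (t M) + \<delta>)"
      using Suc r by (intro add_left_mono mult_left_mono) auto
    finally show ?case by (simp add: algebra_simps)
  qed
  have "(\<lambda>k. r ^ k * norm (t M)) \<longlonglongrightarrow> 0"
    using r by (intro tendsto_mult_left_zero LIMSEQ_power_zero) auto
  from LIMSEQ_D[OF this, of \<delta>] \<delta>(1) obtain k0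
    where k0: "\<And>k. k \<ge> k0 \<Longrightarrow> \<bar>r ^ k * norm (t M)\<bar> < \<delta>" by auto
  have "norm (norm (t n) - 0) < \<epsilon>" if "n \<ge> M + k0" for n
  proof -
    have "n - M \<ge> k0" "M + (n - M) = n" using that by auto
    thus ?thesis using bound[of "n - M"] k0[of "n - M"] \<delta>(2) by auto
  qed
  thus "\<exists>no. \<forall>n\<ge>no. norm (norm (t n) - 0) < \<epsilon>" by blast
qed

text \<open>
  Factoring \<open>q\<close> over the complex numbers, each factor \<open>T - z\<close> can be undone by the previous lemma.
\<close>

lemma shift_poly_tendsto_0_imp:
  fixes q :: "complex poly"
  assumes "q \<noteq> 0" and "\<And>z. poly q z = 0 \<Longrightarrow> norm z < 1"
    and "shift_poly q s \<longlonglongrightarrow> 0"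
  shows "s \<longlonglongrightarrow> 0"
  using assms
proof (induction "degree q" arbitrary: q)
  case 0
  then obtain a where q: "q = [:a:]" "a \<noteq> 0" by (metis degree_eq_zeroE pCons_0_0)
  have "(\<lambda>n. inverse a * shift_poly q s n) \<longlonglongrightarrow> 0"
    using 0 by (intro tendsto_mult_right_zero) auto
  thus ?case using q by (simp add: shift_poly_def)
next
  case (Suc m)
  then obtain z where z: "poly q z = 0"
    using fundamental_theorem_of_algebra[of q] by (metis constant_degree nat.distinct(1))
  then obtain q' where q': "q = [:-z, 1:] * q'" by (auto simp: poly_eq_0_iff_dvd elim: dvdE)
  have "q' \<noteq> 0" using Suc.prems q' by auto
  have "degree q = Suc (degree q')"
    unfolding q' using \<open>q' \<noteq> 0\<close> by (subst degree_mult_eq) auto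
  hence "m = degree q'" using Suc.hyps(2) by simp
  moreover have "norm w < 1" if "poly q' w = 0" for w
    by (rule Suc.prems(2)) (use that in \<open>simp only: q' poly_mult mult_zero_right\<close>)
  moreover have "(\<lambda>n. shift_poly q' s (Suc n) - z * shift_poly q' s n) \<longlonglongrightarrow> 0"
    using Suc.prems(3) unfolding q' shift_poly_linear_factor[symmetric] .
  hence "shift_poly q' s \<longlonglongrightarrow> 0"
    by (rule contracting_recurrence_tendsto_0[OF Suc.prems(2)[OF z]])
  ultimately show ?case
    using \<open>q' \<noteq> 0\<close> by (intro Suc.hyps(1)[of q']) 
qed

section \<open>Growth of a Pisot numeration\<close>

lemma poly_of_rat_add:
  "poly (map_poly of_rat (p + q)) (z::'a::field_char_0)
     = poly (map_poly of_rat p) z + poly (map_poly of_rat q) z"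
proof -
  have "map_poly of_rat (p + q) = (map_poly of_rat p + map_poly of_rat q :: 'a poly)"
    by (rule poly_eqI) (simp add: coeff_map_poly of_rat_add)
  thus ?thesis by simp
qed

lemma poly_of_rat_mult:
  "poly (map_poly of_rat (p * q)) (z::'a::field_char_0)
     = poly (map_poly of_rat p) z * poly (map_poly of_rat q) z"
proof (induction p)
  case (pCons a p)
  have "map_poly of_rat (smult a q) = (smult (of_rat a) (map_poly of_rat q) :: 'a poly)"
    by (rule poly_eqI) (simp add: coeff_map_poly of_rat_mult)
  thus ?case using pCons
    by (simp add: poly_of_rat_add map_poly_pCons algebra_simps)
qed simp

text \<open>
  Separability in characteristic zero: \<open>p\<close> does not divide its derivative, which has smaller
  degree, so irreducibility makes the two coprime and a Bezout identity forbids a common root in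
  any extension field.
\<close>

lemma irreducible_poly_simple_roots:
  fixes p :: "rat poly" and z :: "'a::field_char_0"
  assumes "irreducible p" and "poly (map_poly of_rat p) z = 0"
  shows "poly (pderiv (map_poly of_rat p)) z \<noteq> 0"
proof
  assume "poly (pderiv (map_poly of_rat p)) z = 0"
  moreover have "pderiv (map_poly of_rat p) = (map_poly of_rat (pderiv p) :: 'a poly)"
    by (rule poly_eqI) (simp add: coeff_pderiv coeff_map_poly of_rat_mult of_rat_add)
  ultimately have z: "poly (map_poly of_rat (pderiv p)) z = 0" by simp
  have deg: "degree p \<noteq> 0"
    using assms(1) by (auto simp: irreducible_def is_unit_iff_degree)
  have "coprime p (pderiv p)"
  proof (rule coprimeI)
    fix c assume c: "c dvd p" "c dvd pderiv p"
    from irreducibleD'[OF assms(1) c(1)] show "is_unit c"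
    proof
      assume "p dvd c"
      hence "p dvd pderiv p" using c(2) by (rule dvd_trans)
      thus ?thesis using deg by simp
    qed
  qed
  then obtain a b where "a * p + b * pderiv p = 1"
    using bezout_coefficients_fst_snd[of p "pderiv p"] by (metis coprime_imp_gcd_eq_1)
  hence "poly (map_poly of_rat (a * p + b * pderiv p)) z = (1 :: 'a)"
    by (simp add: map_poly_1)
  thus False using z assms(2) by (simp add: poly_of_rat_add poly_of_rat_mult)
qed

text \<open>
  Let \<open>P = (X - \<beta>) Q\<close> be the minimal polynomial. The sequence \<open>y n = U (n + 1) - \<beta> U n\<close> satisfies
  the recurrence with characteristic polynomial \<open>Q\<close>, whose roots are the other conjugates of \<open>\<beta>\<close>
  and therefore lie in the open unit disc; hence \<open>y\<close> tends to \<open>0\<close>. Since \<open>U n \<ge> 1\<close>, the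
  difference \<open>y n / U n\<close> between the ratio and \<open>\<beta>\<close> tends to \<open>0\<close> as well.
\<close>

lemma pisot_numeration_ratio_tendsto:
  assumes "pisot_numeration \<beta> U"
  shows "(\<lambda>n. real_of_int (U (Suc n)) / real_of_int (U n)) \<longlonglongrightarrow> \<beta>"
proof -
  from assms obtain P :: "int poly" and v :: "int \<Rightarrow> int" where
    pisot: "pisot \<beta>" and pos: "\<And>n. U n > 0" and
    mp: "is_min_poly \<beta> (map_poly of_int P)" and
    v: "\<And>n. v (int n) = U n" and
    rec: "\<And>n. n \<ge> 1 \<Longrightarrow> v n = (\<Sum>i<degree P. - coeff P i * v (n - int (degree P) + int i))"
    by (auto simp: pisot_numeration_def)
  define PC :: "complex poly" where "PC = map_poly of_int P"
  have PC: "PC = map_poly of_rat (map_poly of_int P)"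
    unfolding PC_def by (rule poly_eqI) (simp add: coeff_map_poly)
  have irr: "irreducible (map_poly of_int P :: rat poly)"
    and lead: "lead_coeff (map_poly of_int P :: rat poly) = 1"
    using mp by (auto simp: is_min_poly_def)
  have degP: "degree (map_poly of_int P :: rat poly) = degree P"
    and degPC: "degree PC = degree P"
    by (auto simp: PC_def intro!: degree_map_poly)
  have lead1: "coeff P (degree P) = 1" using lead by (simp add: degP coeff_map_poly)
  have "degree P \<noteq> 0"
    using irr degP by (auto simp: irreducible_def is_unit_iff_degree)
  have root: "poly PC (of_real \<beta>) = 0"
  proof -
    have "PC = map_poly of_real (map_poly of_rat (map_poly of_int P :: rat poly))"
      unfolding PC by (rule poly_eqI) (simp add: coeff_map_poly)
    hence "poly PC (of_real \<beta>) = of_real (poly (map_poly of_rat (map_poly of_int P :: rat poly)) \<beta>)"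
      by (simp add: poly_altdef coeff_map_poly degree_map_poly)
    thus ?thesis using mp by (simp add: is_min_poly_def)
  qed
  then obtain Q where Q: "PC = [:- of_real \<beta>, 1:] * Q"
    by (auto simp: poly_eq_0_iff_dvd elim: dvdE)
  have "Q \<noteq> 0" using Q \<open>degree P \<noteq> 0\<close> degPC by auto
  have disc: "norm z < 1" if "poly Q z = 0" for z
  proof -
    \<comment> \<open>The root \<open>\<beta>\<close> of \<open>P\<close> is simple, so it is not a root of \<open>Q\<close> again.\<close>
    have "poly (pderiv PC) (of_real \<beta>) = poly Q (of_real \<beta>)"
      unfolding Q by (simp add: pderiv_mult pderiv_pCons del: mult_pCons_left)
    hence "poly Q (of_real \<beta>) \<noteq> 0"
      using irreducible_poly_simple_roots[OF irr] root unfolding PC by metis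
    hence "z \<noteq> of_real \<beta>" using that by auto
    moreover have "poly PC z = 0" unfolding Q using that by simp
    hence "z \<in> galois_conjugates \<beta>" unfolding PC galois_conjugates_def using mp by blast
    ultimately show ?thesis using pisot by (auto simp: pisot_def)
  qed
  have "shift_poly PC (\<lambda>n. of_int (U n)) n = 0" for n
  proof -
    have "v (int (n + degree P)) = (\<Sum>i<degree P. - coeff P i * v (int (n + i)))"
      using \<open>degree P \<noteq> 0\<close> by (subst rec) (auto intro!: sum.cong simp: algebra_simps)
    hence "(\<Sum>i\<le>degree P. coeff P i * U (n + i)) = 0"
      unfolding v by (simp add: lessThan_Suc_atMost[symmetric] lead1 sum_negf)
    hence "complex_of_int (\<Sum>i\<le>degree P. coeff P i * U (n + i)) = 0" by simp
    thus ?thesis unfolding shift_poly_def degPC by (simp add: PC_def coeff_map_poly)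
  qed
  hence y0: "shift_poly Q (\<lambda>n. of_int (U (Suc n)) - of_real \<beta> * of_int (U n)) = (\<lambda>_. 0)"
    unfolding Q shift_poly_linear_factor' by (rule ext)
  have "(\<lambda>n. complex_of_int (U (Suc n)) - of_real \<beta> * of_int (U n)) \<longlonglongrightarrow> 0"
    by (rule shift_poly_tendsto_0_imp[OF \<open>Q \<noteq> 0\<close> disc]) (simp_all add: y0)
  hence "(\<lambda>n. complex_of_real (real_of_int (U (Suc n)) - \<beta> * of_int (U n))) \<longlonglongrightarrow> of_real 0"
    by simp
  hence y: "(\<lambda>n. real_of_int (U (Suc n)) - \<beta> * of_int (U n)) \<longlonglongrightarrow> 0"
    by (simp only: tendsto_of_real_iff)
  have "(\<lambda>n. real_of_int (U (Suc n)) / of_int (U n) - \<beta>) \<longlonglongrightarrow> 0"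
  proof (rule Lim_null_comparison[OF _ tendsto_norm_zero[OF y]], rule always_eventually, rule allI)
    fix n
    have u: "real_of_int (U n) \<ge> 1" using pos[of n] by simp
    hence "real_of_int (U (Suc n)) / of_int (U n) - \<beta> = (of_int (U (Suc n)) - \<beta> * of_int (U n)) / of_int (U n)"
      by (simp add: field_simps)
    also have "norm \<dots> \<le> norm (of_int (U (Suc n)) - \<beta> * of_int (U n)) / 1"
      unfolding norm_divide using u by (intro divide_left_mono) auto
    finally show "norm (real_of_int (U (Suc n)) / of_int (U n) - \<beta>)
        \<le> norm (of_int (U (Suc n)) - \<beta> * of_int (U n))" by simp
  qed
  thus ?thesis by (simp add: LIM_zero_iff)
qed

section \<open>Greedy expansions\<close>

text \<open>
  The greedy algorithm, run from position \<open>L\<close> downwards: the digit at \<open>L\<close> is \<open>n div U L\<close>, and the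
  remainder \<open>n mod U L\<close> is below \<open>U L\<close>, which is both the greedy inequality at \<open>L - 1\<close> and the
  hypothesis needed to go on.
\<close>

lemma greedy_prefix_exists:
  fixes U :: "nat \<Rightarrow> int"
  assumes pos: "\<And>n. U n > 0" and U0: "U 0 = 1" and "0 \<le> n" "n < U L"
  shows "\<exists>d. (\<forall>i. 0 \<le> d i) \<and> (\<forall>i\<ge>L. d i = 0) \<and> (\<Sum>i<L. d i * U i) = n \<and>
           (\<forall>l<L. (\<Sum>i\<le>l. d i * U i) < U (Suc l))"
  using assms(3,4)
proof (induction L arbitrary: n)
  case 0
  thus ?case by (intro exI[of _ "\<lambda>_. 0"]) (simp add: U0)
next
  case (Suc L)
  obtain d where d: "\<forall>i. 0 \<le> d i" "\<forall>i\<ge>L. d i = 0" "(\<Sum>i<L. d i * U i) = n mod U L"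
    "\<forall>l<L. (\<Sum>i\<le>l. d i * U i) < U (Suc l)"
    using Suc.IH[of "n mod U L"] pos[of L] by auto
  define d' where "d' = d(L := n div U L)"
  have low: "(\<Sum>i\<le>l. d' i * U i) = (\<Sum>i\<le>l. d i * U i)" if "l < L" for l
    unfolding d'_def using that by (intro sum.cong) auto
  have "(\<Sum>i<L. d' i * U i) = n mod U L"
    unfolding d(3)[symmetric] d'_def by (intro sum.cong) auto
  hence total: "(\<Sum>i<Suc L. d' i * U i) = n" by (simp add: d'_def)
  show ?case
  proof (intro exI[of _ d'] conjI allI impI)
    show "0 \<le> d' i" for i
      using d(1) Suc.prems pos[of L] by (simp add: d'_def pos_imp_zdiv_nonneg_iff)
    show "(\<Sum>i\<le>l. d' i * U i) < U (Suc l)" if "l < Suc L" for l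
      using that low[of l] d(4) total Suc.prems
      by (cases "l = L") (auto simp: lessThan_Suc_atMost)
  qed (use d(2) total in \<open>auto simp: d'_def\<close>)
qed

text \<open>
  Divergence of \<open>U\<close> gives a position \<open>L\<close> beyond which every weight exceeds \<open>n\<close>; there the greedy
  inequalities hold because the prefix sums never exceed \<open>n\<close>.
\<close>

lemma is_greedy_greedy_expansion:
  assumes pos: "\<And>n. U n > 0" and U0: "U 0 = 1" and lim: "filterlim U at_top sequentially"
  shows "is_greedy U n (greedy_expansion U n)"
proof -
  obtain L where L: "\<And>l. l \<ge> L \<Longrightarrow> U l > int n"
    using filterlim_at_top[THEN iffD1, OF lim, rule_format, of "int n + 1"]
    unfolding eventually_sequentially by (auto simp: add1_zle_eq)
  obtain d where d: "\<forall>i. 0 \<le> d i" "\<forall>i\<ge>L. d i = 0" "(\<Sum>i<L. d i * U i) = int n"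
    "\<forall>l<L. (\<Sum>i\<le>l. d i * U i) < U (Suc l)"
    using greedy_prefix_exists[of U "int n" L, OF pos U0] L[of L] by auto
  have tail: "(\<Sum>i\<le>l. d i * U i) = int n" if "l \<ge> L" for l
    unfolding d(3)[symmetric] using that d(2)
    by (intro sum.mono_neutral_right) auto
  have "is_greedy U n d"
    unfolding is_greedy_iff[of U, OF pos U0]
  proof (intro conjI allI)
    have "{i. d i \<noteq> 0} \<subseteq> {..<L}" using d(2) by (auto simp: not_le[symmetric])
    hence "d \<in> finite_seqs" unfolding finite_seqs_def using finite_subset by auto
    thus "d \<in> representations U n"
      using d(1,2) tail[of L] seq_value_eq_sum[of L d U] by (simp add: representations_def)
    show "(\<Sum>i\<le>l. d i * U i) < U (Suc l)" for l
      using d(4) tail[of l] L[of "Suc l"] by (cases "l < L") auto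
  qed
  thus ?thesis using greedy_expansion_eqI by metis
qed

section \<open>Numerations whose ratios converge\<close>

text \<open>
  The convergence of the ratios is the only asymptotic information about \<open>U\<close> that the passage from
  integers to real numbers uses.
\<close>

locale growing_numeration =
  fixes U :: "nat \<Rightarrow> int" and \<beta> :: real
  assumes U_pos: "\<And>n. U n > 0" and U_0: "U 0 = 1" and \<beta>_gt_1: "\<beta> > 1"
    and ratio: "(\<lambda>n. real_of_int (U (Suc n)) / real_of_int (U n)) \<longlonglongrightarrow> \<beta>"
begin

lemma ratio_power: "(\<lambda>n. real_of_int (U (n + j)) / real_of_int (U n)) \<longlonglongrightarrow> \<beta> ^ j"
proof (induction j)
  case 0
  have "U n \<noteq> 0" for n using U_pos[of n] by simp
  thus ?case by simp
next
  case (Suc j)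
  have "(\<lambda>n. real_of_int (U (Suc (n + j))) / real_of_int (U (n + j))
           * (real_of_int (U (n + j)) / real_of_int (U n))) \<longlonglongrightarrow> \<beta> * \<beta> ^ j"
    using LIMSEQ_ignore_initial_segment[OF ratio, of j] by (intro tendsto_mult Suc)
  moreover have "U n \<noteq> 0" for n using U_pos[of n] by simp
  ultimately show ?case by simp
qed

text \<open>
  The bridge between the two numerations: the value of a fixed word placed at position \<open>n\<close>, measured
  in units of \<open>U n\<close>, tends to its value in base \<open>\<beta>\<close>.
\<close>

lemma weighted_sum_ratio:
  "(\<lambda>n. real_of_int (\<Sum>j\<in>A. a j * U (n + f j)) / real_of_int (U n))
     \<longlonglongrightarrow> (\<Sum>j\<in>A. of_int (a j) * \<beta> ^ f j)"
proof -
  have "(\<lambda>n. \<Sum>j\<in>A. of_int (a j) * (real_of_int (U (n + f j)) / real_of_int (U n)))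
     \<longlonglongrightarrow> (\<Sum>j\<in>A. of_int (a j) * \<beta> ^ f j)"
    by (intro tendsto_intros ratio_power)
  thus ?thesis by (simp add: sum_divide_distrib)
qed

lemma geometric_growth:
  obtains \<rho> M where "\<rho> > 1" "\<forall>n\<ge>M. \<forall>j. \<rho> ^ j * real_of_int (U n) \<le> real_of_int (U (n + j))"
proof -
  define \<rho> where "\<rho> = (1 + \<beta>) / 2"
  have \<rho>: "1 < \<rho>" "\<rho> < \<beta>" using \<beta>_gt_1 by (auto simp: \<rho>_def)
  obtain M where M: "\<And>n. n \<ge> M \<Longrightarrow> real_of_int (U (Suc n)) / real_of_int (U n) > \<rho>"
    using order_tendstoD(1)[OF ratio \<rho>(2)] unfolding eventually_sequentially by blast
  have step: "\<rho> * real_of_int (U n) \<le> real_of_int (U (Suc n))" if "n \<ge> M" for n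
    using M[OF that] U_pos[of n] by (simp add: field_simps)
  have "\<rho> ^ j * real_of_int (U n) \<le> real_of_int (U (n + j))" if "n \<ge> M" for n j
  proof (induction j)
    case (Suc j)
    have "\<rho> ^ Suc j * real_of_int (U n) \<le> \<rho> * real_of_int (U (n + j))"
      using Suc \<rho> by simp
    also have "\<dots> \<le> real_of_int (U (n + Suc j))" using step[of "n + j"] that by simp
    finally show ?case .
  qed simp
  thus ?thesis using that \<rho>(1) by blast
qed

lemma U_at_top: "filterlim U at_top sequentially"
proof -
  obtain \<rho> M where \<rho>: "\<rho> > 1"
    "\<forall>n\<ge>M. \<forall>j. \<rho> ^ j * real_of_int (U n) \<le> real_of_int (U (n + j))"
    by (rule geometric_growth)
  show ?thesis
    unfolding filterlim_at_top eventually_sequentially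
  proof
    fix Z
    obtain L where L: "real_of_int Z < \<rho> ^ L" using real_arch_pow[OF \<rho>(1)] by blast
    have "Z \<le> U n" if "n \<ge> M + L" for n
    proof -
      have "\<rho> ^ L \<le> \<rho> ^ (n - M) * 1"
        using that \<rho>(1) by (simp add: power_increasing)
      also have "\<dots> \<le> \<rho> ^ (n - M) * real_of_int (U M)"
        using \<rho>(1) U_pos[of M] by (intro mult_left_mono) auto
      also have "\<dots> \<le> real_of_int (U n)" using \<rho>(2)[rule_format, of M "n - M"] that by simp
      finally show ?thesis using L by linarith
    qed
    thus "\<exists>k. \<forall>n\<ge>k. Z \<le> U n" by blast
  qed
qed

section \<open>Greedy words and their limits\<close>

lemma greedy_expansion_nonneg: "greedy_expansion U n i \<ge> 0"
  and greedy_expansion_prefix_less: "(\<Sum>i\<le>l. greedy_expansion U n i * U i) < U (Suc l)"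
  and greedy_expansion_finite: "greedy_expansion U n \<in> finite_seqs"
  and greedy_expansion_value: "seq_value U (greedy_expansion U n) = int n"
  using is_greedy_greedy_expansion[OF U_pos U_0 U_at_top, of n]
  unfolding is_greedy_iff[of U, OF U_pos U_0] representations_def by auto

lemma greedy_digit_term_less: "greedy_expansion U n i * U i < U (Suc i)"
proof -
  have "greedy_expansion U n i * U i \<le> (\<Sum>j\<le>i. greedy_expansion U n j * U j)"
    using greedy_expansion_nonneg U_pos
    by (intro member_le_sum[of i _ "\<lambda>j. greedy_expansion U n j * U j"]) (auto simp: less_imp_le)
  thus ?thesis using greedy_expansion_prefix_less[of n i] by linarith
qed

lemma greedy_digits_bounded:
  obtains B :: nat where "\<forall>n i. greedy_expansion U n i \<le> int B"
proof -
  obtain C where C: "\<And>i. norm (real_of_int (U (Suc i)) / real_of_int (U i)) \<le> C"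
    using convergent_imp_Bseq[OF convergentI[OF ratio]] unfolding Bseq_def by blast
  have "greedy_expansion U n i \<le> int (nat \<lceil>C\<rceil>)" for n i
  proof -
    have "real_of_int (greedy_expansion U n i) * real_of_int (U i) \<le> real_of_int (U (Suc i))"
      using greedy_digit_term_less[of n i]
      by (metis less_imp_le of_int_le_iff of_int_mult)
    hence "real_of_int (greedy_expansion U n i) \<le> real_of_int (U (Suc i)) / real_of_int (U i)"
      using U_pos[of i] by (simp add: field_simps)
    also have "\<dots> \<le> C" using C[of i] by (metis abs_le_D1 real_norm_def)
    finally have "greedy_expansion U n i \<le> \<lceil>C\<rceil>" by linarith
    thus ?thesis by linarith
  qed
  thus ?thesis using that by blast
qed

lemma greedy_digit_zero_above: "int n < U i \<Longrightarrow> greedy_expansion U n i = 0"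
proof (rule ccontr)
  let ?e = "greedy_expansion U n"
  assume less: "int n < U i" and nz: "?e i \<noteq> 0"
  have "U i \<le> ?e i * U i"
    using nz greedy_expansion_nonneg[of n i] U_pos[of i] by simp
  also have "\<dots> \<le> seq_value U ?e"
    unfolding seq_value_def using nz greedy_expansion_finite[of n] greedy_expansion_nonneg U_pos
    by (intro member_le_sum[of i _ "\<lambda>j. ?e j * U j"]) (auto simp: finite_seqs_def less_imp_le)
  finally show False using less by (simp add: greedy_expansion_value)
qed

text \<open>
  If \<open>N n\<close> is of the order of \<open>U n\<close>, its leading digit is at most a bounded number of positions above
  \<open>n\<close>, because the weights grow geometrically from a certain index on.
\<close>

lemma greedy_window:
  assumes lim: "(\<lambda>n. real (N n) / real_of_int (U n)) \<longlonglongrightarrow> y"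
  obtains L where "\<forall>\<^sub>F n in sequentially. \<forall>j\<ge>L. greedy_expansion U (N n) (n + j) = 0"
proof -
  obtain \<rho> M where \<rho>: "\<rho> > 1"
    "\<forall>n\<ge>M. \<forall>j. \<rho> ^ j * real_of_int (U n) \<le> real_of_int (U (n + j))"
    by (rule geometric_growth)
  obtain L where L: "y < \<rho> ^ L" using real_arch_pow[OF \<rho>(1)] by blast
  have "\<forall>\<^sub>F n in sequentially. \<forall>j\<ge>L. greedy_expansion U (N n) (n + j) = 0"
    using order_tendstoD(2)[OF lim L] eventually_ge_at_top[of M]
  proof eventually_elim
    case (elim n)
    show ?case
    proof (intro allI impI greedy_digit_zero_above)
      fix j assume "j \<ge> L"
      have "real (N n) < \<rho> ^ L * real_of_int (U n)"
        using elim(1) U_pos[of n] by (simp add: field_simps)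
      also have "\<dots> \<le> \<rho> ^ j * real_of_int (U n)"
        using \<open>j \<ge> L\<close> \<rho>(1) U_pos[of n] by (intro mult_right_mono power_increasing) auto
      also have "\<dots> \<le> real_of_int (U (n + j))" using \<rho>(2) elim(2) by blast
      finally show "int (N n) < U (n + j)" by linarith
    qed
  qed
  thus ?thesis by (rule that)
qed

text \<open>
  When the expansion of \<open>N n\<close> has no digits below position \<open>n\<close>, it lives in a window of bounded length,
  with digits from a bounded range. So only finitely many words occur, and one of them occurs for
  infinitely many \<open>n\<close>. Along those \<open>n\<close> the equation for the value and the greedy inequalities pass to
  the limit; the strict inequalities become weak ones.
\<close>

lemma limit_greedy_word:
  assumes lim: "(\<lambda>n. real (N n) / real_of_int (U n)) \<longlonglongrightarrow> y"
    and zeros: "\<And>n i. i < n \<Longrightarrow> greedy_expansion U (N n) i = 0"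
  obtains w :: "nat \<Rightarrow> nat" and L where "\<forall>j>L. w j = 0"
    and "(\<Sum>j\<le>L. real (w j) * \<beta> ^ j) = y"
    and "\<forall>l. (\<Sum>j\<le>l. real (w j) * \<beta> ^ j) \<le> \<beta> ^ Suc l"
proof -
  define e where "e n = greedy_expansion U (N n)" for n
  define word where "word n = (\<lambda>j. nat (e n (n + j)))" for n
  have e_word: "e n (n + j) = int (word n j)" for n j
    using greedy_expansion_nonneg by (simp add: word_def e_def)
  obtain B :: nat where B: "\<forall>n i. greedy_expansion U n i \<le> int B"
    by (rule greedy_digits_bounded)
  obtain L where "\<forall>\<^sub>F n in sequentially. \<forall>j\<ge>L. e n (n + j) = 0"
    using greedy_window[OF lim] unfolding e_def by blast
  then obtain M where M: "\<And>n j. n \<ge> M \<Longrightarrow> j \<ge> L \<Longrightarrow> e n (n + j) = 0"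
    unfolding eventually_sequentially by blast
  let ?W = "{w :: nat \<Rightarrow> nat. \<forall>j. (j \<in> {..<L} \<longrightarrow> w j \<in> {..B}) \<and> (j \<notin> {..<L} \<longrightarrow> w j = 0)}"
  have "word ` {M..} \<subseteq> ?W"
    using M B by (auto simp: word_def e_def nat_le_iff)
  moreover have "finite ?W" by (intro finite_set_of_finite_funs) auto
  ultimately have "finite (word ` {M..})" by (rule finite_subset)
  then obtain m where m: "m \<ge> M" "infinite {n \<in> {M..}. word n = word m}"
    using pigeonhole_infinite[of "{M..}" word] infinite_Ici[of M] by auto
  define w where "w = word m"
  have w0: "w j = 0" if "j \<ge> L" for j using M[OF m(1) that] by (simp add: w_def word_def)
  \<comment> \<open>The filter of all large \<open>n\<close> at which the word \<open>w\<close> occurs; limits along it are limits along a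
    subsequence.\<close>
  define F where "F = inf sequentially (principal {n. n \<ge> M \<and> word n = w})"
  have "F \<noteq> bot"
    using m(2) unfolding F_def trivial_limit_def eventually_inf_principal
    by (simp add: cofinite_eq_sequentially[symmetric] eventually_cofinite w_def)
  have F_le: "F \<le> sequentially" by (simp add: F_def)
  have ev: "\<forall>\<^sub>F n in F. n \<ge> M \<and> word n = w"
    unfolding F_def eventually_inf_principal by simp
  let ?S = "\<lambda>l n. \<Sum>j\<le>l. int (w j) * U (n + j)"
  have prefix: "(\<Sum>i\<le>n + l. e n i * U i) = ?S l n" if "word n = w" for n l
  proof (induction l)
    case 0
    have "(\<Sum>i<n. e n i * U i) = 0" using zeros by (intro sum.neutral) (auto simp: e_def)
    thus ?case using e_word[of n 0] that by (simp add: lessThan_Suc_atMost[symmetric])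
  next
    case (Suc l)
    thus ?case using e_word[of n "Suc l"] that by simp
  qed
  have S_lim: "((\<lambda>n. real_of_int (?S l n) / real_of_int (U n)) \<longlongrightarrow> (\<Sum>j\<le>l. real (w j) * \<beta> ^ j)) F" for l
    using tendsto_mono[OF F_le weighted_sum_ratio[of "\<lambda>j. int (w j)" "\<lambda>j. j" "{..l}"]] by simp
  show ?thesis
  proof (rule that[of L w])
    show "\<forall>j>L. w j = 0" using w0 by simp
    have "\<forall>\<^sub>F n in F. real (N n) / real_of_int (U n) = real_of_int (?S L n) / real_of_int (U n)"
      using ev
    proof eventually_elim
      case (elim n)
      have "e n i = 0" if "i > n + L" for i
        using M[of n "i - n"] elim that by simp
      hence "int (N n) = (\<Sum>i\<le>n + L. e n i * U i)"
        using seq_value_eq_sum[of "n + L" "e n" U] greedy_expansion_value[of "N n"]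
        by (simp add: e_def)
      also have "\<dots> = ?S L n" using prefix elim by blast
      finally show ?case by (metis of_int_of_nat_eq)
    qed
    hence "((\<lambda>n. real_of_int (?S L n) / real_of_int (U n)) \<longlongrightarrow> y) F"
      using tendsto_mono[OF F_le lim] by (simp only: tendsto_cong)
    thus "(\<Sum>j\<le>L. real (w j) * \<beta> ^ j) = y"
      using tendsto_unique[OF \<open>F \<noteq> bot\<close> S_lim] by blast
    have "\<forall>\<^sub>F n in F. real_of_int (?S l n) / real_of_int (U n) \<le> real_of_int (U (n + Suc l)) / real_of_int (U n)" for l
      using ev
    proof eventually_elim
      case (elim n)
      have "?S l n < U (n + Suc l)"
        using prefix[of n l] elim greedy_expansion_prefix_less[of "N n" "n + l"] by (simp add: e_def)
      thus ?case using U_pos[of n] by (intro divide_right_mono) (auto simp del: of_int_sum)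
    qed
    thus "\<forall>l. (\<Sum>j\<le>l. real (w j) * \<beta> ^ j) \<le> \<beta> ^ Suc l"
      by (intro allI tendsto_le[OF \<open>F \<noteq> bot\<close> tendsto_mono[OF F_le ratio_power] S_lim])
  qed
qed

end

section \<open>Finite beta-expansions\<close>

text \<open>
  Let \<open>m\<close> be the largest position at which the weak greedy inequality is an equality; one exists
  unless all are strict, since the prefix sums are bounded while the powers of \<open>\<beta>\<close> are not. The
  digits up to \<open>m\<close> have total value \<open>\<beta> ^ (m + 1)\<close>, so they may be erased in favour of a carry into
  position \<open>m + 1\<close>. Prefix sums beyond \<open>m\<close> do not change, and there the inequalities were already
  strict by the choice of \<open>m\<close>. A single carry therefore suffices.
\<close>

lemma carry_to_strictly_greedy:
  fixes w :: "nat \<Rightarrow> nat" and \<beta> :: real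
  assumes "\<beta> > 1" and w0: "\<forall>j>L. w j = 0"
    and le: "\<forall>l. (\<Sum>j\<le>l. real (w j) * \<beta> ^ j) \<le> \<beta> ^ Suc l"
  obtains w' :: "nat \<Rightarrow> nat" and L' where "\<forall>j>L'. w' j = 0"
    and "(\<Sum>j\<le>L'. real (w' j) * \<beta> ^ j) = (\<Sum>j\<le>L. real (w j) * \<beta> ^ j)"
    and "\<forall>l. (\<Sum>j\<le>l. real (w' j) * \<beta> ^ j) < \<beta> ^ Suc l"
proof -
  define S where "S l = (\<Sum>j\<le>l. real (w j) * \<beta> ^ j)" for l
  define E where "E = {l. S l = \<beta> ^ Suc l}"
  have S_const: "S l = S L" if "l \<ge> L" for l
    unfolding S_def using that w0 by (intro sum.mono_neutral_right) auto
  have strict: "S l < \<beta> ^ Suc l" if "l \<notin> E" for l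
    using le[rule_format, of l] that by (simp add: E_def S_def)
  show ?thesis
  proof (cases "E = {}")
    case True
    thus ?thesis using that[of L w] w0 strict by (auto simp: S_def)
  next
    case False
    obtain n where n: "S L < \<beta> ^ n" using real_arch_pow[OF assms(1)] by blast
    have "l \<le> max L n" if "l \<in> E" for l
    proof (rule ccontr)
      assume "\<not> l \<le> max L n"
      moreover from this have "\<beta> ^ n \<le> \<beta> ^ Suc l"
        using assms(1) by (intro power_increasing) auto
      ultimately show False using that n S_const[of l] by (simp add: E_def)
    qed
    hence "finite E" by (meson finite_nat_set_iff_bounded_le)
    define m where "m = Max E"
    have m: "S m = \<beta> ^ Suc m" "\<And>l. l > m \<Longrightarrow> l \<notin> E"
      using Max_in[OF \<open>finite E\<close> False] Max_ge[OF \<open>finite E\<close>] 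
      unfolding m_def[symmetric] by (auto simp: E_def not_le[symmetric])
    define w' where "w' j = (if j \<le> m then 0 else if j = Suc m then w j + 1 else w j)" for j
    have T: "(\<Sum>j\<le>l. real (w' j) * \<beta> ^ j) = (if l \<le> m then 0 else S l)" for l
    proof (induction l)
      case (Suc l)
      consider "Suc l \<le> m" | "l = m" | "l > m" by linarith
      thus ?case using Suc m(1) by cases (auto simp: w'_def S_def algebra_simps)
    qed (simp add: w'_def)
    show ?thesis
    proof (rule that[of "max L (Suc m)" w'])
      show "\<forall>j>max L (Suc m). w' j = 0" using w0 by (simp add: w'_def)
      show "(\<Sum>j\<le>max L (Suc m). real (w' j) * \<beta> ^ j) = (\<Sum>j\<le>L. real (w j) * \<beta> ^ j)"
        unfolding T using S_const[of "max L (Suc m)"] by (auto simp: S_def)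
      show "\<forall>l. (\<Sum>j\<le>l. real (w' j) * \<beta> ^ j) < \<beta> ^ Suc l"
        unfolding T using strict[OF m(2)] assms(1) by auto
    qed
  qed
qed

text \<open>
  A word in base \<open>\<beta>\<close> that represents \<open>\<beta> ^ K * x\<close> becomes an expansion of \<open>x\<close> with \<open>K\<close>
  fractional digits.
\<close>

lemma in_Fin_if_strictly_greedy:
  fixes w :: "nat \<Rightarrow> nat"
  assumes "\<beta> > 0" and w0: "\<forall>j>L. w j = 0"
    and strict: "\<forall>l. (\<Sum>j\<le>l. real (w j) * \<beta> ^ j) < \<beta> ^ Suc l"
    and x: "\<beta> ^ K * x = (\<Sum>j\<le>L. real (w j) * \<beta> ^ j)"
  shows "x \<in> Fin \<beta>"
proof -
  define d where "d i = (if i \<ge> - int K then w (nat (i + int K)) else 0)" for i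
  let ?f = "\<lambda>i. real (d i) * \<beta> powi i"
  have sum: "(?f has_sum (\<Sum>j\<le>l. real (w j) * \<beta> ^ j) / \<beta> ^ K) {..int l - int K}" for l
  proof (rule has_sum_finite_neutralI)
    show "(\<Sum>j\<le>l. real (w j) * \<beta> ^ j) / \<beta> ^ K = sum ?f ((\<lambda>j. int j - int K) ` {..l})"
      using assms(1)
      by (subst sum.reindex) (auto simp: inj_on_def d_def power_int_diff sum_divide_distrib)
    fix i assume i: "i \<in> {..int l - int K} - (\<lambda>j. int j - int K) ` {..l}"
    have "i < - int K"
    proof (rule ccontr)
      assume "\<not> i < - int K"
      hence "i = int (nat (i + int K)) - int K" "nat (i + int K) \<le> l" using i by auto
      thus False using i by blast
    qed
    thus "?f i = 0" by (simp add: d_def)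
  qed auto
  have "is_beta_expansion \<beta> x d"
    unfolding is_beta_expansion_def
  proof (intro exI[of _ "int L - int K"] conjI allI impI)
    show "d i = 0" if "i > int L - int K" for i
      using that w0[rule_format, of "nat (i + int K)"] by (auto simp: d_def)
    have "x = (\<Sum>j\<le>L. real (w j) * \<beta> ^ j) / \<beta> ^ K" using x assms(1) by (simp add: field_simps)
    thus "(?f has_sum x) {..int L - int K}" using sum[of L] by simp
    fix k
    show "(\<Sum>\<^sub>\<infinity>i\<in>{..k}. ?f i) < \<beta> powi (k + 1)"
    proof (cases "k \<ge> - int K")
      case True
      define l where "l = nat (k + int K)"
      have k: "k = int l - int K" using True by (simp add: l_def)
      have "k + 1 = int (Suc l) - int K" using k by simp
      hence "\<beta> powi (k + 1) = \<beta> powi (int (Suc l) - int K)" by (rule arg_cong)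
      also have "\<dots> = \<beta> powi int (Suc l) / \<beta> powi int K"
        by (rule power_int_diff) (use assms(1) in auto)
      finally have "\<beta> powi (k + 1) = \<beta> ^ Suc l / \<beta> ^ K" by (simp only: power_int_of_nat)
      thus ?thesis
        using infsumI[OF sum[of l]] strict[rule_format, of l] assms(1) unfolding k
        by (simp add: divide_strict_right_mono)
    next
      case False
      hence "(\<Sum>\<^sub>\<infinity>i\<in>{..k}. ?f i) = 0" by (intro infsum_0) (auto simp: d_def)
      thus ?thesis using assms(1) by simp
    qed
  qed
  moreover have "finite {i. d i \<noteq> 0}"
  proof (rule finite_subset)
    show "{i. d i \<noteq> 0} \<subseteq> {- int K..int L - int K}"
    proof
      fix i assume "i \<in> {i. d i \<noteq> 0}"
      thus "i \<in> {- int K..int L - int K}"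
        using w0[rule_format, of "nat (i + int K)"] by (cases "i > int L - int K") (auto simp: d_def split: if_splits)
    qed
  qed simp
  moreover have "0 \<le> \<beta> ^ K * x" unfolding x using assms(1) by (intro sum_nonneg) auto
  hence "x \<ge> 0" using assms(1) by (metis not_le zero_le_mult_iff zero_less_power)
  ultimately show ?thesis unfolding Fin_def by blast
qed

section \<open>From preserved zeros to Condition F\<close>

definition shifted_coeffs :: "nat \<Rightarrow> int poly \<Rightarrow> nat \<Rightarrow> int" where
  "shifted_coeffs m p i = (if i < m then 0 else coeff p (i - m))"

lemma shifted_coeffs_finite: "shifted_coeffs m p \<in> finite_seqs"
proof -
  have "{i. shifted_coeffs m p i \<noteq> 0} \<subseteq> {..m + degree p}"
    by (auto simp: shifted_coeffs_def coeff_eq_0 not_le[symmetric] split: if_splits)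
       (metis coeff_eq_0 le_add_diff_inverse linorder_not_less nat_add_left_cancel_le)
  thus ?thesis unfolding finite_seqs_def using finite_subset by blast
qed

lemma seq_value_shifted_coeffs:
  "seq_value U (shifted_coeffs m p) = (\<Sum>j\<le>degree p. coeff p j * U (m + j))"
proof -
  let ?g = "\<lambda>i. shifted_coeffs m p i * U i"
  have "seq_value U (shifted_coeffs m p) = sum ?g ((+) m ` {..degree p})"
    unfolding seq_value_def
  proof (rule sum.mono_neutral_left)
    show "{i. shifted_coeffs m p i \<noteq> 0} \<subseteq> (+) m ` {..degree p}"
    proof
      fix i assume "i \<in> {i. shifted_coeffs m p i \<noteq> 0}"
      hence "i \<ge> m" "coeff p (i - m) \<noteq> 0" by (auto simp: shifted_coeffs_def split: if_splits)
      hence "i = m + (i - m)" "i - m \<in> {..degree p}" by (auto intro: le_degree)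
      thus "i \<in> (+) m ` {..degree p}" by blast
    qed
  qed auto
  also have "\<dots> = (\<Sum>j\<le>degree p. coeff p j * U (m + j))"
    by (subst sum.reindex) (auto simp: shifted_coeffs_def)
  finally show ?thesis .
qed

text \<open>
  The shifts of the coefficient sequence of \<open>p\<close> all have the same norm, so a single constant \<open>K\<close>
  serves all of them.
\<close>

lemma preserves_zeros_greedy_digit:
  assumes "preserves_zeros U"
  obtains K where "\<And>m i. i < m \<Longrightarrow>
    greedy_expansion U (nat \<bar>\<Sum>j\<le>degree p. coeff p j * U (m + K + j)\<bar>) i = 0"
proof -
  define c where "c = nat (\<Sum>j\<le>degree p. \<bar>coeff p j\<bar>)"
  have coeff_le: "\<bar>coeff p j\<bar> \<le> int c" for j
  proof (cases "j \<le> degree p")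
    case True
    hence "\<bar>coeff p j\<bar> \<le> (\<Sum>j\<le>degree p. \<bar>coeff p j\<bar>)"
      by (intro member_le_sum[of j _ "\<lambda>j. \<bar>coeff p j\<bar>"]) auto
    thus ?thesis by (simp add: c_def)
  qed (simp add: coeff_eq_0)
  obtain K where K: "\<And>g. g \<in> finite_seqs \<Longrightarrow> sup_norm_seq g \<le> int c \<Longrightarrow>
      ord_seq g \<le> nu U (seq_value U g) + enat K"
    using assms unfolding preserves_zeros_def by blast
  show ?thesis
  proof (rule that[of K], rule ccontr)
    fix m i :: nat assume "i < (m :: nat)"
    let ?g = "shifted_coeffs (m + K) p"
    let ?e = "greedy_expansion U (nat \<bar>\<Sum>j\<le>degree p. coeff p j * U (m + K + j)\<bar>)"
    assume "?e i \<noteq> 0"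
    hence "nu U (seq_value U ?g) \<le> enat i"
      unfolding nu_def ord_seq_def seq_value_shifted_coeffs by (intro INF_lower) simp
    moreover have "sup_norm_seq ?g \<le> int c"
      unfolding sup_norm_seq_def using coeff_le
      by (intro cSUP_least) (auto simp: shifted_coeffs_def)
    hence "ord_seq ?g \<le> nu U (seq_value U ?g) + enat K"
      by (intro K shifted_coeffs_finite)
    moreover have "enat (m + K) \<le> ord_seq ?g"
      unfolding ord_seq_def
      by (intro INF_greatest) (auto simp: shifted_coeffs_def split: if_splits)
    ultimately have "enat (m + K) \<le> enat i + enat K"
      by (meson add_right_mono order_trans)
    thus False using \<open>i < m\<close> by simp
  qed
qed

theorem proposition45:
  fixes \<beta> :: real and U :: "nat \<Rightarrow> int"
  assumes "pisot_numeration \<beta> U"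
    and "preserves_zeros U"
  shows "condition_F \<beta>"
  unfolding condition_F_def
proof (intro ballI impI)
  interpret growing_numeration U \<beta>
    using assms(1) pisot_numeration_ratio_tendsto[OF assms(1)]
    by unfold_locales (auto simp: pisot_numeration_def pisot_def)
  fix x assume "x \<in> Z_adjoin \<beta>" "x \<ge> 0"
  then obtain p :: "int poly" where x: "x = poly (map_poly of_int p) \<beta>"
    by (auto simp: Z_adjoin_def)
  obtain K where K: "\<And>n i. i < n \<Longrightarrow>
      greedy_expansion U (nat \<bar>\<Sum>j\<le>degree p. coeff p j * U (n + K + j)\<bar>) i = 0"
    using preserves_zeros_greedy_digit[OF assms(2)] by blast
  define N where "N n = nat \<bar>\<Sum>j\<le>degree p. coeff p j * U (n + (K + j))\<bar>" for n
  have "(\<Sum>j\<le>degree p. of_int (coeff p j) * \<beta> ^ (K + j)) = \<beta> ^ K * x"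
    unfolding x by (simp add: poly_altdef degree_map_poly coeff_map_poly sum_distrib_left power_add algebra_simps)
  hence "(\<lambda>n. real_of_int (\<Sum>j\<le>degree p. coeff p j * U (n + (K + j))) / real_of_int (U n))
      \<longlonglongrightarrow> \<beta> ^ K * x"
    using weighted_sum_ratio[of "coeff p" "\<lambda>j. K + j" "{..degree p}"] by simp
  \<comment> \<open>Greedy expansions are taken of the absolute values. As the limit is not negative, this does
    not change it, even if \<open>x = 0\<close> and the signs of the integers vary.\<close>
  hence "(\<lambda>n. \<bar>real_of_int (\<Sum>j\<le>degree p. coeff p j * U (n + (K + j))) / real_of_int (U n)\<bar>)
      \<longlonglongrightarrow> \<bar>\<beta> ^ K * x\<bar>"
    by (rule tendsto_rabs)
  moreover have "\<bar>\<beta> ^ K * x\<bar> = \<beta> ^ K * x" using \<open>x \<ge> 0\<close> \<beta>_gt_1 by simp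
  moreover have "real (N n) / real_of_int (U n)
      = \<bar>real_of_int (\<Sum>j\<le>degree p. coeff p j * U (n + (K + j))) / real_of_int (U n)\<bar>" for n
    using U_pos[of n] by (simp add: N_def abs_divide del: of_int_sum)
  ultimately have lim: "(\<lambda>n. real (N n) / real_of_int (U n)) \<longlonglongrightarrow> \<beta> ^ K * x"
    by simp
  have zeros: "greedy_expansion U (N n) i = 0" if "i < n" for n i
    using K[OF that] by (simp add: N_def add.assoc)
  obtain w :: "nat \<Rightarrow> nat" and L where w: "\<forall>j>L. w j = 0"
    "(\<Sum>j\<le>L. real (w j) * \<beta> ^ j) = \<beta> ^ K * x"
    "\<forall>l. (\<Sum>j\<le>l. real (w j) * \<beta> ^ j) \<le> \<beta> ^ Suc l"
    by (rule limit_greedy_word[OF lim zeros])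
  obtain w' :: "nat \<Rightarrow> nat" and L' where w': "\<forall>j>L'. w' j = 0"
    "(\<Sum>j\<le>L'. real (w' j) * \<beta> ^ j) = (\<Sum>j\<le>L. real (w j) * \<beta> ^ j)"
    "\<forall>l. (\<Sum>j\<le>l. real (w' j) * \<beta> ^ j) < \<beta> ^ Suc l"
    by (rule carry_to_strictly_greedy[OF \<beta>_gt_1 w(1,3)])
  show "x \<in> Fin \<beta>"
    using in_Fin_if_strictly_greedy[OF _ w'(1,3), of K x] w(2) w'(2) \<beta>_gt_1 by simp
qed

end
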